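(* Let $L$ be a reduced multiplicative lattice and suppose that $\mathrm{Clique}(\Gamma^m(L)) < \infty$. Then $L$ has a finite number of minimal prime ideals, and if $n$ is this number then $\chi(\Gamma^m(L)) = \mathrm{Clique}(\Gamma^m(L)) = n$.
   Context: A multiplicative lattice is a complete lattice $L$ (least element $0$, greatest element $1$) with a binary operation $\cdot$ satisfying: (1) $a\cdot b=b\cdot a$; (2) $a\cdot(b\cdot c)=(a\cdot b)\cdot c$; (3) $a\cdot\left(\bigvee_\alpha b_\alpha\right)=\bigvee_\alpha (a\cdot b_\alpha)$ for arbitrary joins; (4) $a\cdot b\le a\wedge b$; (5) $a\cdot 1=a$. An element $a\in L$ is nilpotent if $a^n=0$ for some positive integer $n$ (powers with respect to $\cdot$); $L$ is reduced if $0$ is its only nilpotent element. Ideals here are lattice ideals: a nonempty subset $I\subseteq L$ such that $x\le a\in I$ implies $x\in I$, and $a,b\in I$ implies $a\vee b\in I$. A proper ideal $I$ is prime if $a\wedge b\in I$ implies $a\in I$ or $b\in I$. A prime ideal $I$ is a minimal prime ideal if there is no prime ideal $Q$ with $\{0\}\subsetneq Q\subsetneq I$. The zero-divisor graph $\Gamma^m(L)$ is the simple undirected graph with vertex set $\{x\in L : x\neq 0 \text{ and } x\cdot y=0 \text{ for some } y\in L,\ y\ne 0\}$, in which two distinct vertices $a,b$ are adjacent if and only if $a\cdot b=0$. $\chi(G)$ denotes the chromatic number of a graph $G$, and $\mathrm{Clique}(G)$ denotes its clique number, i.e. the supremum of the sizes of complete subgraphs of $G$.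
   Formalization: The formal theorem additionally assumes that {0} is not a prime ideal of L; otherwise the graph has no vertices, so its chromatic and clique numbers are 0, while {0} itself counts as a minimal prime ideal and the claim fails (e.g. L = {0,1}). *)

theory Defs
  imports Main "HOL-Library.Extended_Nat" "HOL-Library.Ramsey"
begin

section \<open>Multiplicative lattices\<close>

text \<open>
  The least element of the lattice is \<^term>\<open>bot\<close>. The greatest element \<^term>\<open>top\<close> is identified
  with the unit \<^term>\<open>1\<close> of the multiplication, so that powers are the library's monoid powers.
\<close>

class multiplicative_lattice = complete_lattice + comm_monoid_mult +
  assumes one_eq_top: "1 = top"
    and mult_Sup: "a * Sup B = Sup ((*) a ` B)"
    and mult_le_inf: "a * b \<le> inf a b"

definition nilpotent :: "'a::multiplicative_lattice \<Rightarrow> bool" where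
  "nilpotent a \<longleftrightarrow> (\<exists>n>0. a ^ n = bot)"

text \<open>Reducedness is a property of the whole lattice, which here is the type \<^typ>\<open>'a\<close>.\<close>

definition reduced :: "'a::multiplicative_lattice itself \<Rightarrow> bool" where
  "reduced _ \<longleftrightarrow> (\<forall>a::'a. nilpotent a \<longleftrightarrow> a = bot)"

section \<open>Lattice ideals\<close>

text \<open>Primality refers to the meet, not to the multiplication.\<close>

definition lattice_ideal :: "'a::lattice set \<Rightarrow> bool" where
  "lattice_ideal I \<longleftrightarrow> I \<noteq> {} \<and> (\<forall>a\<in>I. \<forall>x. x \<le> a \<longrightarrow> x \<in> I) \<and> (\<forall>a\<in>I. \<forall>b\<in>I. sup a b \<in> I)"

definition prime_lattice_ideal :: "'a::lattice set \<Rightarrow> bool" where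
  "prime_lattice_ideal I \<longleftrightarrow>
     lattice_ideal I \<and> I \<noteq> UNIV \<and> (\<forall>a b. inf a b \<in> I \<longrightarrow> a \<in> I \<or> b \<in> I)"

text \<open>
  Since the ideal \<open>Q\<close> below has to be different from \<^term>\<open>{bot}\<close>, this is minimality in the set of
  all prime ideals only as long as \<^term>\<open>{bot}\<close> is not prime itself.
\<close>

definition minimal_prime_lattice_ideal :: "'a::bounded_lattice set \<Rightarrow> bool" where
  "minimal_prime_lattice_ideal I \<longleftrightarrow>
     prime_lattice_ideal I \<and> \<not> (\<exists>Q. prime_lattice_ideal Q \<and> {bot} \<subset> Q \<and> Q \<subset> I)"

section \<open>Clique number and chromatic number\<close>

text \<open>
  As for \<^const>\<open>clique\<close>, a simple graph is given by its vertex set and the set of its edges, which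
  are two-element sets of vertices. Both invariants take the value \<open>\<infinity>\<close> for all infinite
  cardinalities.
\<close>

definition clique_number :: "'v set \<Rightarrow> 'v set set \<Rightarrow> enat" where
  "clique_number V E = (SUP K \<in> {K. K \<subseteq> V \<and> clique K E}. if finite K then enat (card K) else \<infinity>)"

definition proper_colouring :: "'v set \<Rightarrow> 'v set set \<Rightarrow> nat \<Rightarrow> ('v \<Rightarrow> nat) \<Rightarrow> bool" where
  "proper_colouring V E k c \<longleftrightarrow>
     c ` V \<subseteq> {..<k} \<and> (\<forall>a\<in>V. \<forall>b\<in>V. {a, b} \<in> E \<longrightarrow> c a \<noteq> c b)"

definition chromatic_number :: "'v set \<Rightarrow> 'v set set \<Rightarrow> enat" where
  "chromatic_number V E = (INF k \<in> {k. \<exists>c. proper_colouring V E k c}. enat k)"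

section \<open>The zero-divisor graph\<close>

definition zd_vertices :: "'a::multiplicative_lattice set" where
  "zd_vertices = {x. x \<noteq> bot \<and> (\<exists>y. y \<noteq> bot \<and> x * y = bot)}"

definition zd_edges :: "'a::multiplicative_lattice set set" where
  "zd_edges = {{a, b} | a b. a \<in> zd_vertices \<and> b \<in> zd_vertices \<and> a \<noteq> b \<and> a * b = bot}"

text \<open>
  If \<^term>\<open>{bot}\<close> is prime, then the zero-divisor graph has no vertices, although \<^term>\<open>{bot}\<close> is a
  minimal prime ideal. For a reduced lattice with \<^term>\<open>bot \<noteq> top\<close> this is the only way in which
  the graph can be empty.
\<close>

lemma inf_power2_le_mult:
  fixes a b :: "'a::multiplicative_lattice"
  shows "(inf a b) ^ 2 \<le> a * b"
proof -
  have mono: "x * y \<le> x * z" if "y \<le> z" for x y z :: 'a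
    using mult_Sup[of x "{y, z}"] that by (simp add: sup_absorb2 le_iff_sup)
  have "inf a b * inf a b \<le> inf a b * b" by (intro mono) simp
  also have "\<dots> = b * inf a b" by (simp add: mult.commute)
  also have "\<dots> \<le> b * a" by (intro mono) simp
  finally show ?thesis by (simp add: power2_eq_square mult.commute)
qed

lemma reduced_mult_eq_bot_iff:
  fixes a b :: "'a::multiplicative_lattice"
  assumes "reduced TYPE('a)"
  shows "a * b = bot \<longleftrightarrow> inf a b = bot"
proof
  assume "a * b = bot"
  then have "(inf a b) ^ 2 = bot" using inf_power2_le_mult[of a b] by (simp add: bot_unique)
  then have "nilpotent (inf a b)" unfolding nilpotent_def by (intro exI[of _ 2]) simp
  then show "inf a b = bot" using assms by (simp add: reduced_def)
next
  assume "inf a b = bot"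
  then show "a * b = bot" using mult_le_inf[of a b] by (simp add: bot_unique)
qed

lemma prime_bot_iff_no_zero_divisors:
  assumes "reduced TYPE('a::multiplicative_lattice)"
  shows "prime_lattice_ideal {bot::'a} \<longleftrightarrow> (bot::'a) \<noteq> top \<and> (zd_vertices :: 'a set) = {}"
proof -
  have "{bot::'a} \<noteq> UNIV \<longleftrightarrow> (bot::'a) \<noteq> top"
    by (metis UNIV_I UNIV_eq_I bot.extremum_unique singleton_iff top_greatest)
  then show ?thesis
    using reduced_mult_eq_bot_iff[OF assms]
    by (auto simp: prime_lattice_ideal_def lattice_ideal_def zd_vertices_def bot_unique)
qed

lemma minimal_prime_bot:
  "prime_lattice_ideal {bot::'a::bounded_lattice} \<Longrightarrow> minimal_prime_lattice_ideal {bot::'a}"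
  by (auto simp: minimal_prime_lattice_ideal_def)

end

theory Submission
  imports Defs
begin

text \<open>
  In a reduced multiplicative lattice, products and meets vanish simultaneously, so the clique number
  is the largest size of a set \<open>K\<close> of nonzero, pairwise disjoint elements. Fix such a \<open>K\<close> of
  maximal size. For \<open>a \<in> K\<close> the annihilator of \<open>a\<close> is a prime ideal, since otherwise \<open>a\<close> could be
  replaced by two disjoint nonzero elements below it, and it is minimal. By maximality of \<open>K\<close> no
  nonzero element annihilates all of \<open>K\<close>, whence every prime ideal contains one of these
  annihilators. So the minimal primes are exactly the annihilators of the elements of \<open>K\<close>, and
  colouring \<open>x\<close> by some \<open>a \<in> K\<close> that \<open>x\<close> does not annihilate is a proper colouring.
\<close>

section \<open>Clique and chromatic number of arbitrary graphs\<close>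

lemma clique_number_le_chromatic_number: "clique_number V E \<le> chromatic_number V E"
  unfolding clique_number_def chromatic_number_def
proof (intro SUP_least INF_greatest, clarsimp)
  fix K k c
  assume K: "K \<subseteq> V" "clique K E" and c: "proper_colouring V E k c"
  have "inj_on c K" and sub: "c ` K \<subseteq> {..<k}"
    using K c unfolding inj_on_def proper_colouring_def clique_def by blast+
  then show "(finite K \<longrightarrow> card K \<le> k) \<and> finite K"
    using card_inj_on_le[of c K "{..<k}"] inj_on_finite[of c K "{..<k}"] by auto
qed

lemma clique_number_attained:
  assumes "clique_number V E < \<infinity>"
  obtains K where "K \<subseteq> V" "clique K E" "finite K" "clique_number V E = enat (card K)"
proof -
  define A where "A = (\<lambda>K. if finite K then enat (card K) else \<infinity>) ` {K. K \<subseteq> V \<and> clique K E}"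
  have Sup: "clique_number V E = Sup A"
    by (simp add: clique_number_def A_def)
  have ne: "A \<noteq> {}"
    by (auto simp: A_def clique_def intro!: exI[of _ "{}"])
  obtain n where "clique_number V E = enat n"
    using assms by auto
  \<comment> \<open>A set of extended naturals bounded by a natural number is finite, so its
    supremum is a maximum. The empty clique makes \<open>A\<close> nonempty.\<close>
  then have "finite A"
    using Sup by (intro finite_enat_bounded[of A n]) (metis Sup_upper)
  then have "Sup A \<in> A"
    using ne Max_in by (simp add: Sup_enat_def)
  with assms that show thesis
    unfolding Sup A_def by (auto split: if_splits)
qed

lemma card_le_clique_number:
  assumes "K \<subseteq> V" "clique K E" "finite K"
  shows "enat (card K) \<le> clique_number V E"
  unfolding clique_number_def using assms by (intro SUP_upper2[of K]) auto

section \<open>Orthogonal sets and annihilators\<close>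

definition orthogonal_set :: "'a::bounded_lattice_bot set \<Rightarrow> bool" where
  "orthogonal_set S \<longleftrightarrow> bot \<notin> S \<and> pairwise (\<lambda>x y. inf x y = bot) S"

text \<open>Largest in cardinality, not just maximal under inclusion: the primality argument trades
  one element for two, which inclusion-maximality would not forbid.\<close>

definition maximum_orthogonal_set :: "'a::bounded_lattice_bot set \<Rightarrow> bool" where
  "maximum_orthogonal_set K \<longleftrightarrow>
     finite K \<and> orthogonal_set K \<and> (\<forall>S::'a set. finite S \<longrightarrow> orthogonal_set S \<longrightarrow> card S \<le> card K)"

text \<open>Stated with meets, to match primality. In a reduced multiplicative lattice the condition
  means \<open>x * a = bot\<close>. In a general lattice this set need not be closed under
  joins.\<close>

definition annihilator :: "'a::bounded_lattice_bot \<Rightarrow> 'a set" where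
  "annihilator a = {x. inf x a = bot}"

lemma orthogonal_set_insertI:
  assumes "orthogonal_set S" "x \<noteq> bot" "\<And>y. y \<in> S \<Longrightarrow> inf x y = bot"
  shows "orthogonal_set (insert x S)"
  using assms by (simp add: orthogonal_set_def pairwise_insert inf_commute[of _ x])

lemma maximum_orthogonal_set_annihilated:
  assumes K: "maximum_orthogonal_set K" and x: "\<And>a. a \<in> K \<Longrightarrow> x \<in> annihilator a"
  shows "x = bot"
proof (rule ccontr)
  assume "x \<noteq> bot"
  then have "orthogonal_set (insert x K)"
    using K x by (intro orthogonal_set_insertI) (auto simp: maximum_orthogonal_set_def annihilator_def)
  moreover have "x \<notin> K"
    using \<open>x \<noteq> bot\<close> x[of x] by (auto simp: annihilator_def)
  ultimately show False
    using K unfolding maximum_orthogonal_set_def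
    by (metis card_insert_disjoint finite_insert not_less_eq_eq order_refl)
qed

lemma inf_mem_annihilator_imp:
  assumes K: "maximum_orthogonal_set K" and a: "a \<in> K" and xy: "inf x y \<in> annihilator a"
  shows "x \<in> annihilator a \<or> y \<in> annihilator a"
proof (rule ccontr)
  assume "\<not> ?thesis"
  then have ne: "inf x a \<noteq> bot" "inf y a \<noteq> bot"
    by (auto simp: annihilator_def)
  have fin: "finite K" and orth: "orthogonal_set K"
    using K by (auto simp: maximum_orthogonal_set_def)
  have disj: "inf (inf x a) (inf y a) = bot"
    using xy by (simp add: annihilator_def inf_aci)
  have below: "inf (inf z a) b = bot" if "b \<in> K - {a}" for z b
    using orth a that unfolding orthogonal_set_def pairwise_def
    by (metis Diff_iff inf_assoc inf_bot_right insertI1)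
  let ?S = "insert (inf x a) (insert (inf y a) (K - {a}))"
  have "orthogonal_set ?S"
  proof (intro orthogonal_set_insertI)
    show "orthogonal_set (K - {a})"
      using orth by (auto simp: orthogonal_set_def intro: pairwise_subset)
  qed (use ne disj below in auto)
  \<comment> \<open>If \<open>inf x a\<close> and \<open>inf y a\<close> coincided, or either lay in
    \<open>K - {a}\<close>, that element would be orthogonal to itself, hence \<open>bot\<close>. So
    the exchange gains exactly one element.\<close>
  moreover have "inf x a \<notin> insert (inf y a) (K - {a})" "inf y a \<notin> K - {a}"
    using ne disj below by (metis inf_idem insertE)+
  then have "card ?S = Suc (card K)"
    using fin a by (simp add: card_Suc_Diff1 del: card_Diff_insert)
  ultimately show False
    using K fin unfolding maximum_orthogonal_set_def
    by (metis finite_Diff finite_insert not_less_eq_eq order_refl)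
qed

text \<open>This yields minimality. Since \<open>a\<close> does not annihilate itself, it lies
  outside \<open>Q\<close>; each \<open>x\<close> in the annihilator has
  \<open>inf x a = bot\<close> in \<open>Q\<close>, so primality puts \<open>x\<close> into
  \<open>Q\<close>.\<close>

lemma prime_subset_annihilator:
  assumes "prime_lattice_ideal Q" "Q \<subseteq> annihilator a" "a \<noteq> bot"
  shows "Q = annihilator a"
proof -
  have "bot \<in> Q"
    using assms(1) unfolding prime_lattice_ideal_def lattice_ideal_def by (metis bot_least ex_in_conv)
  moreover have "a \<notin> Q"
    using assms by (auto simp: annihilator_def)
  ultimately have "x \<in> Q" if "x \<in> annihilator a" for x
    using assms(1) that unfolding prime_lattice_ideal_def annihilator_def by (metis mem_Collect_eq)
  then show ?thesis
    using assms(2) by blast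
qed

text \<open>Otherwise choose an element outside \<open>Q\<close> from each annihilator. By primality
  their meet stays outside \<open>Q\<close>, yet it annihilates all of \<open>K\<close> and so is
  \<open>bot\<close>, which lies in \<open>Q\<close>.\<close>

lemma prime_contains_annihilator:
  assumes K: "maximum_orthogonal_set K" and Q: "prime_lattice_ideal Q"
  obtains a where "a \<in> K" "annihilator a \<subseteq> Q"
proof (rule ccontr)
  assume "\<not> thesis"
  then have ex: "\<exists>x. x \<notin> Q \<and> x \<in> annihilator a" if "a \<in> K" for a
    using that \<open>\<And>a. a \<in> K \<Longrightarrow> annihilator a \<subseteq> Q \<Longrightarrow> thesis\<close> by blast
  have "finite K"
    using K by (simp add: maximum_orthogonal_set_def)
  then have "\<exists>x. x \<notin> Q \<and> (\<forall>a\<in>K. x \<in> annihilator a)"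
    using ex
  proof (induction rule: finite_induct)
    case empty
    \<comment> \<open>The empty meet is replaced by any element outside the proper ideal
      \<open>Q\<close>.\<close>
    then show ?case using Q by (auto simp: prime_lattice_ideal_def)
  next
    case (insert b F)
    then obtain x y where "x \<notin> Q" "\<forall>a\<in>F. x \<in> annihilator a" "y \<notin> Q" "y \<in> annihilator b"
      by (metis insert_iff)
    moreover from this have "inf x y \<notin> Q"
      using Q by (auto simp: prime_lattice_ideal_def)
    moreover have "inf x y \<in> annihilator c" if "x \<in> annihilator c \<or> y \<in> annihilator c" for c
      using that unfolding annihilator_def mem_Collect_eq
      by (metis inf_assoc inf_bot_right inf_commute)
    ultimately show ?case by blast
  qed
  then obtain x where "x \<notin> Q" "\<forall>a\<in>K. x \<in> annihilator a" by blast
  moreover have "bot \<in> Q"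
    using Q unfolding prime_lattice_ideal_def lattice_ideal_def by (metis bot_least ex_in_conv)
  ultimately show False
    using maximum_orthogonal_set_annihilated[OF K] by blast
qed

text \<open>Meets need not distribute over joins, but products do. Reducedness turns the meet
  condition into a product condition and back.\<close>

lemma lattice_ideal_annihilator:
  fixes a :: "'a::multiplicative_lattice"
  assumes "reduced TYPE('a)"
  shows "lattice_ideal (annihilator a)"
proof -
  have "inf (sup x y) a = bot" if "inf x a = bot" "inf y a = bot" for x y
  proof -
    have "a * x = bot" "a * y = bot"
      using that reduced_mult_eq_bot_iff[OF assms] by (auto simp: inf_commute)
    then have "a * sup x y = bot"
      using mult_Sup[of a "{x, y}"] by simp
    then show ?thesis
      using reduced_mult_eq_bot_iff[OF assms] by (simp add: inf_commute)
  qed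
  moreover have "inf x a = bot" if "inf y a = bot" "x \<le> y" for x y
    using that by (metis bot_unique inf_mono order_refl)
  moreover have "bot \<in> annihilator a"
    by (simp add: annihilator_def)
  ultimately show ?thesis
    unfolding lattice_ideal_def annihilator_def by blast
qed

lemma minimal_primes_eq_annihilators:
  fixes K :: "'a::multiplicative_lattice set"
  assumes red: "reduced TYPE('a)" and np: "\<not> prime_lattice_ideal {bot::'a}"
    and K: "maximum_orthogonal_set K"
  shows "{I. minimal_prime_lattice_ideal I} = annihilator ` K"
proof -
  have ne: "a \<noteq> bot" if "a \<in> K" for a
    using K that by (auto simp: maximum_orthogonal_set_def orthogonal_set_def)
  have prime: "prime_lattice_ideal (annihilator a)" if "a \<in> K" for a
  proof -
    have "a \<notin> annihilator a"
      using ne[OF that] by (simp add: annihilator_def)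
    then show ?thesis
      using lattice_ideal_annihilator[OF red] inf_mem_annihilator_imp[OF K that]
      unfolding prime_lattice_ideal_def by blast
  qed
  show ?thesis
  proof (intro equalityI subsetI)
    fix I :: "'a set" assume "I \<in> {I. minimal_prime_lattice_ideal I}"
    then have I: "prime_lattice_ideal I" "\<not> (\<exists>Q. prime_lattice_ideal Q \<and> {bot} \<subset> Q \<and> Q \<subset> I)"
      by (auto simp: minimal_prime_lattice_ideal_def)
    obtain a where a: "a \<in> K" "annihilator a \<subseteq> I"
      using prime_contains_annihilator[OF K I(1)] .
    \<comment> \<open>The definition of minimality only compares with primes strictly above
      \<open>{bot}\<close>, so \<open>np\<close> is what lets this annihilator count as a competitor
      of \<open>I\<close>.\<close>
    moreover have "annihilator a \<noteq> {bot}"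
      using prime[OF a(1)] np by metis
    then have "{bot} \<subset> annihilator a"
      by (auto simp: annihilator_def)
    ultimately show "I \<in> annihilator ` K"
      using I(2) prime by blast
  next
    fix I assume "I \<in> annihilator ` K"
    then show "I \<in> {I. minimal_prime_lattice_ideal I}"
      using prime ne prime_subset_annihilator by (auto simp: minimal_prime_lattice_ideal_def)
  qed
qed

text \<open>Distinct \<open>a\<close> and \<open>b\<close> annihilate each other; with equal
  annihilators, \<open>a\<close> would annihilate itself and be \<open>bot\<close>.\<close>

lemma inj_on_annihilator:
  assumes "orthogonal_set K"
  shows "inj_on annihilator K"
proof (rule inj_onI)
  fix a b assume "a \<in> K" "b \<in> K" "annihilator a = annihilator b"
  then show "a = b"
    using assms unfolding orthogonal_set_def pairwise_def annihilator_def
    by (metis (mono_tags, lifting) inf_idem mem_Collect_eq)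
qed

section \<open>Transfer to the zero-divisor graph\<close>

lemma orthogonal_set_if_clique:
  fixes K :: "'a::multiplicative_lattice set"
  assumes "reduced TYPE('a)" "K \<subseteq> zd_vertices" "clique K zd_edges"
  shows "orthogonal_set K"
proof -
  have "a * b = bot" if "{a, b} \<in> zd_edges" for a b :: 'a
    using that by (auto simp: zd_edges_def doubleton_eq_iff mult.commute)
  then show ?thesis
    using assms reduced_mult_eq_bot_iff[OF assms(1)]
    unfolding orthogonal_set_def pairwise_def clique_def by (auto simp: zd_vertices_def)
qed

text \<open>With at least two elements, each is a zero-divisor because of another one, so the set is
  itself a clique. A single element, such as \<open>top\<close>, need not be a vertex.\<close>

lemma card_orthogonal_set_le_clique_number:
  fixes S :: "'a::multiplicative_lattice set"
  assumes red: "reduced TYPE('a)" and np: "\<not> prime_lattice_ideal {bot::'a}"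
    and S: "finite S" "orthogonal_set S"
  shows "enat (card S) \<le> clique_number (zd_vertices :: 'a set) zd_edges"
proof -
  consider "S = {}" | x where "S = {x}" | "\<And>x. x \<in> S \<Longrightarrow> \<exists>y\<in>S. y \<noteq> x"
    by (metis is_singletonI' is_singleton_def)
  then show ?thesis
  proof cases
    case 1
    then show ?thesis by (simp add: zero_enat_def[symmetric])
  next
    case 2
    then have "(bot::'a) \<noteq> top"
      using S(2) by (metis bot_unique insertI1 orthogonal_set_def top_greatest)
    \<comment> \<open>Any vertex gives a clique of the required size one; \<open>np\<close> ensures
      that the graph has a vertex.\<close>
    then obtain v :: 'a where "v \<in> zd_vertices"
      using np prime_bot_iff_no_zero_divisors[OF red] by blast
    then have "enat (card {v}) \<le> clique_number (zd_vertices :: 'a set) zd_edges"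
      by (intro card_le_clique_number) (auto simp: clique_def)
    then show ?thesis using 2 by simp
  next
    case 3
    have mult: "x * y = bot" if "x \<in> S" "y \<in> S" "x \<noteq> y" for x y
      using S(2) that reduced_mult_eq_bot_iff[OF red]
      by (auto simp: orthogonal_set_def pairwise_def)
    have V: "S \<subseteq> zd_vertices"
    proof
      fix x assume "x \<in> S"
      moreover obtain y where "y \<in> S" "y \<noteq> x"
        using 3 \<open>x \<in> S\<close> by metis
      ultimately show "x \<in> zd_vertices"
        using mult[of x y] S(2) unfolding zd_vertices_def orthogonal_set_def mem_Collect_eq by metis
    qed
    have "{x, y} \<in> zd_edges" if "x \<in> S" "y \<in> S" "x \<noteq> y" for x y
      using mult[OF that] that V by (auto simp: zd_edges_def)
    then have "clique S zd_edges"
      by (simp add: clique_def)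
    with V show ?thesis using S(1) by (intro card_le_clique_number)
  qed
qed

lemma chromatic_number_le_card:
  fixes K :: "'a::multiplicative_lattice set"
  assumes red: "reduced TYPE('a)" and K: "maximum_orthogonal_set K"
  shows "chromatic_number (zd_vertices :: 'a set) zd_edges \<le> enat (card K)"
proof -
  have "finite K" using K by (simp add: maximum_orthogonal_set_def)
  then obtain h where h: "bij_betw h K {..<card K}"
    using ex_bij_betw_finite_nat lessThan_atLeast0 by metis
  have "\<forall>x\<in>zd_vertices. \<exists>a. a \<in> K \<and> x \<notin> annihilator a"
    using maximum_orthogonal_set_annihilated[OF K] by (fastforce simp: zd_vertices_def)
  then obtain f where f: "\<And>x. x \<in> zd_vertices \<Longrightarrow> f x \<in> K \<and> x \<notin> annihilator (f x)"
    by metis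
  have "f x \<noteq> f y" if "x \<in> zd_vertices" "y \<in> zd_vertices" "{x, y} \<in> zd_edges" for x y
  proof
    assume eq: "f x = f y"
    have "x * y = bot"
      using that by (auto simp: zd_edges_def doubleton_eq_iff mult.commute)
    \<comment> \<open>The meet is \<open>bot\<close>, so primality puts \<open>x\<close> or
      \<open>y\<close> into the annihilator of their common value under \<open>f\<close>, against
      the choice of \<open>f\<close>.\<close>
    then have "inf x y \<in> annihilator (f x)"
      using reduced_mult_eq_bot_iff[OF red] by (simp add: annihilator_def)
    then show False
      using inf_mem_annihilator_imp[OF K] f that eq by metis
  qed
  then have "h (f x) \<noteq> h (f y)"
    if "x \<in> zd_vertices" "y \<in> zd_vertices" "{x, y} \<in> zd_edges" for x y
    using that f h by (metis bij_betw_def inj_onD)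
  moreover have "h (f x) < card K" if "x \<in> zd_vertices" for x
    using f[OF that] bij_betwE[OF h] by simp
  ultimately have "proper_colouring zd_vertices zd_edges (card K) (\<lambda>x. h (f x))"
    by (auto simp: proper_colouring_def)
  then show ?thesis
    unfolding chromatic_number_def by (intro INF_lower) blast
qed

theorem theorem2p10:
  assumes "reduced TYPE('a::multiplicative_lattice)"
    and "\<not> prime_lattice_ideal {bot::'a}"
    and "clique_number (zd_vertices :: 'a set) zd_edges < \<infinity>"
  shows "finite {I :: 'a set. minimal_prime_lattice_ideal I} \<and>
    chromatic_number (zd_vertices :: 'a set) zd_edges = clique_number (zd_vertices :: 'a set) zd_edges \<and>
    clique_number (zd_vertices :: 'a set) zd_edges = enat (card {I :: 'a set. minimal_prime_lattice_ideal I})"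
proof -
  obtain K :: "'a set" where K: "K \<subseteq> zd_vertices" "clique K zd_edges" "finite K"
    and n: "clique_number (zd_vertices :: 'a set) zd_edges = enat (card K)"
    using clique_number_attained[OF assms(3)] .
  have orth: "orthogonal_set K"
    using orthogonal_set_if_clique[OF assms(1) K(1,2)] .
  \<comment> \<open>A largest clique is also largest among all orthogonal sets, including those not
    made of vertices.\<close>
  have max: "maximum_orthogonal_set K"
    using card_orthogonal_set_le_clique_number[OF assms(1,2)] K(3) orth n
    by (simp add: maximum_orthogonal_set_def)
  have "chromatic_number (zd_vertices :: 'a set) zd_edges = clique_number (zd_vertices :: 'a set) zd_edges"
    using chromatic_number_le_card[OF assms(1) max] n clique_number_le_chromatic_number
    by (metis order_antisym)
  then show ?thesis
    using minimal_primes_eq_annihilators[OF assms(1,2) max] card_image[OF inj_on_annihilator[OF orth]]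
      K(3) n by simp
qed

end
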